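(* Suppose that $f_d,g_d$, the constraint Jacobians, the projection operators and $b$ are polynomial functions of the state and that $\mathcal M$ and $\mathcal C$ are described by polynomial equalities and inequalities, so that all entries of $A_{\mathrm{int}}(x),A_{\mathrm{bnd}}(x),r_{\mathrm{int}}(x),r_{\mathrm{bnd}}(x)$ are polynomial in $x$. Suppose there exist $\Phi_{\mathrm{int}}\in\Sigma_{\mathrm{int}}$, $\Phi_{\mathrm{bnd}}\in\Sigma_{\mathrm{bnd}}$ and polynomial multipliers $\rho$ such that $$\Phi_{\mathrm{int}}+s_{\mathrm{int}}^2+\varphi_{\mathrm{int}}=0,\qquad \Phi_{\mathrm{bnd}}+s_{\mathrm{bnd}}^2+\varphi_{\mathrm{bnd}}=0,$$ as polynomial identities in $(x,\lambda_{\mathrm{int}},s_{\mathrm{int}})$ and $(x,\lambda_{\mathrm{bnd}},s_{\mathrm{bnd}})$ respectively, where $$\varphi_{\mathrm{int}}=\sum_{q=1}^{n_u}\rho_q\,[\lambda_{\mathrm{int}}^\top A_{\mathrm{int}}(x)]_q+\sum_\ell\rho_\ell^\phi\,\phi_\ell(x)+\rho^s\big(-\lambda_{\mathrm{int}}^\top r_{\mathrm{int}}(x)-s_{\mathrm{int}}^2\big),$$ $$\varphi_{\mathrm{bnd}}=\sum_{q=1}^{n_u}\rho_q\,[\lambda_{\mathrm{bnd}}^\top A_{\mathrm{bnd}}(x)]_q+\sum_\ell\rho_\ell^\phi\,\phi_\ell(x)+\rho^b\,b(x)+\rho^s\big(-\lambda_{\mathrm{bnd}}^\top r_{\mathrm{bnd}}(x)-s_{\mathrm{bnd}}^2\big)$$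 (the polynomial multipliers $\rho$ may be different in the two identities). Then: (interior feasibility) for every $x\in\operatorname{int}(\mathcal D)\cap\mathcal M$ there is no $\lambda\ge0$ with $\lambda^\top A_{\mathrm{int}}(x)=0^\top$ and $\lambda^\top r_{\mathrm{int}}(x)<0$; and (boundary tangency) for every $x\in\partial\mathcal D\cap\mathcal M$ there is no $\lambda\ge0$ with $\lambda^\top A_{\mathrm{bnd}}(x)=0^\top$ and $\lambda^\top r_{\mathrm{bnd}}(x)<0$.
   Context: System: $\dot x_d=f_d(x)+g_d(x)u$, $0=\phi(x)$, with $x=(x_d,x_a)\in\mathbb R^{n_x}$, $u\in\mathbb R^{n_u}$, $\phi=(\phi_\ell)_\ell:\mathbb R^{n_x}\to\mathbb R^{n_m}$ not depending on $u$; $\mathcal M=\{\phi=0\}$, $\mathcal D=\{b\ge0\}$, $\mathcal C=\{h\ge0\}$; input constraints $A_uu\le r_u$. The differentiation index $\nu\ge1$ is the number of time differentiations of the constraint needed to obtain an ODE. $J_d^{(k)},J_a^{(k)}$ are the Jacobians with respect to $x_d,x_a$ of $\frac{d^{k-1}\phi}{dt^{k-1}}$ (expressed as a function of $x$ by eliminating time derivatives through the differential equation); $J_d^{(1)}=\partial\phi/\partial x_d$, $J_a^{(1)}=\partial\phi/\partial x_a$. $P^{(k)}=I_{n_m}-J_a^{(k)}(J_a^{(k)})^\dagger$ ($\dagger$ Moore-Penrose pseudoinverse). $\eta^{(k)}=(J_d^{(k)}f_d)^{d'-1}J_d^{(k)}$, where $d'\ge1$ is the smallest integer with $J_d^{(\nu)}\mathcal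 L_g\mathcal L_f^{d'-1}x_d\ne0$ ($f=f_d$, $g=g_d$); $\eta^{(k)}=J_d^{(k)}$ if $d'=1$ (for $d'\ge2$ the power is meaningful when $n_m=1$), and for $\nu=1$ one takes $\eta^{(1)}=J_d^{(1)}$. Projected fields: $\hat f=\begin{bmatrix}f_d\\-(J_a^{(\nu)})^\dagger J_d^{(\nu)}f_d\end{bmatrix}$, $\hat g=\begin{bmatrix}g_d\\-(J_a^{(\nu)})^\dagger J_d^{(\nu)}g_d\end{bmatrix}$; $\mathcal L_{\hat f}b=\nabla b^\top\hat f$, $\mathcal L_{\hat g}b=\nabla b^\top\hat g$. $\bar P\bar J_df_d$ and $\bar P\bar\eta g_d$ denote the blocks $P^{(k)}J_d^{(k)}f_d$ and $P^{(k)}\eta^{(k)}g_d$ stacked vertically over $k=1,\dots,\nu$. Define $$A_{\mathrm{int}}=\begin{bmatrix}-\bar P\bar\eta g_d\\ \bar P\bar\eta g_d\\ A_u\end{bmatrix},\quad r_{\mathrm{int}}=\begin{bmatrix}\bar P\bar J_df_d\\-\bar P\bar J_df_d\\ r_u\end{bmatrix},\quad A_{\mathrm{bnd}}=\begin{bmatrix}A_{\mathrm{int}}\\-\mathcal L_{\hat g}b\end{bmatrix},\quad r_{\mathrm{bnd}}=\begin{bmatrix}r_{\mathrm{int}}\\ \mathcal L_{\hat f}b\end{bmatrix}.$$ The variables $\lambda_{\mathrm{int}},\lambda_{\mathrm{bnd}}$ are vectors of indeterminates with as many components as $A_{\mathrm{int}},A_{\mathrm{bnd}}$ have rows, and $s_{\mathrm{int}},s_{\mathrm{bnd}}$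 are scalar indeterminates. The cone generated by polynomials $\Phi_1,\dots,\Phi_N$ is $\{\sum_{K\subseteq\{1,\dots,N\}}\gamma_K\prod_{i\in K}\Phi_i:\gamma_K \text{ sums of squares of polynomials}\}$. $\Sigma_{\mathrm{int}}$ is the cone generated by $b(x)$ and the components of $\lambda_{\mathrm{int}}$; $\Sigma_{\mathrm{bnd}}$ is the cone generated by the components of $\lambda_{\mathrm{bnd}}$. *)

theory Defs
  imports "HOL-Analysis.Analysis" "HOL-Library.Poly_Mapping"
begin

text \<open>
  The system is \<open>xd' = fd x + gd x u\<close>, \<open>0 = \<phi> x\<close> with state \<open>x = (xd, xa)\<close>.
\<close>

type_synonym ('d, 'a) state = "(real ^ 'd) \<times> (real ^ 'a)"

definition jac_d :: "(('d::finite, 'a::finite) state \<Rightarrow> real ^ 'n::finite)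
    \<Rightarrow> ('d, 'a) state \<Rightarrow> real ^ 'd ^ 'n"
  where "jac_d F x = jacobian (\<lambda>y. F (y, snd x)) (at (fst x))"

definition jac_a :: "(('d::finite, 'a::finite) state \<Rightarrow> real ^ 'n::finite)
    \<Rightarrow> ('d, 'a) state \<Rightarrow> real ^ 'a ^ 'n"
  where "jac_a F x = jacobian (\<lambda>z. F (fst x, z)) (at (snd x))"

text \<open>
  \<open>\<psi> k\<close> is the \<open>k\<close>-th time derivative of the constraint (\<open>k < \<nu>\<close>), written as a function of the
  state alone. In the chain rule \<open>xd'\<close> is replaced by \<open>fd x + gd x u\<close>, and \<open>xa'\<close> (where it occurs
  at all) by the right-hand side \<open>w x u\<close> of the ordinary differential equation for \<open>xa\<close> that
  \<open>\<nu>\<close> differentiations provide (see \<open>determines_velocity\<close>). The identity being required for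
  every \<open>u\<close> says that the input cancels. If the first \<open>\<nu> - 1\<close> derivatives do not involve \<open>xa'\<close>,
  then \<open>jac_a (\<psi> k) = 0\<close> for \<open>k + 1 < \<nu>\<close> and \<open>w\<close> plays no role here.
\<close>

definition constraint_derivatives ::
  "(('d::finite, 'a::finite) state \<Rightarrow> real ^ 'd) \<Rightarrow> (('d, 'a) state \<Rightarrow> real ^ 'u::finite ^ 'd)
    \<Rightarrow> (('d, 'a) state \<Rightarrow> real ^ 'm::finite) \<Rightarrow> (('d, 'a) state \<Rightarrow> real ^ 'u \<Rightarrow> real ^ 'a)
    \<Rightarrow> nat \<Rightarrow> (nat \<Rightarrow> ('d, 'a) state \<Rightarrow> real ^ 'm) \<Rightarrow> bool"
  where "constraint_derivatives fd gd \<phi> w \<nu> \<psi> \<longleftrightarrow>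
    \<psi> 0 = \<phi> \<and>
    (\<forall>k<\<nu>. \<forall>x. \<psi> k differentiable (at x)) \<and>
    (\<forall>k. Suc k < \<nu> \<longrightarrow>
      (\<forall>x u. \<psi> (Suc k) x = jac_d (\<psi> k) x *v (fd x + gd x *v u) + jac_a (\<psi> k) x *v w x u))"

text \<open>
  The equations obtained from \<open>\<phi> = 0\<close> by at most \<open>k\<close> differentiations determine \<open>xa' = v\<close>
  as a function of \<open>x\<close> and \<open>u\<close>, i.e. they yield an ordinary differential equation.
\<close>

definition determines_velocity ::
  "(('d::finite, 'a::finite) state \<Rightarrow> real ^ 'd) \<Rightarrow> (('d, 'a) state \<Rightarrow> real ^ 'u::finite ^ 'd)
    \<Rightarrow> (nat \<Rightarrow> ('d, 'a) state \<Rightarrow> real ^ 'm::finite) \<Rightarrow> nat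
    \<Rightarrow> (('d, 'a) state \<Rightarrow> real ^ 'u \<Rightarrow> real ^ 'a) \<Rightarrow> bool"
  where "determines_velocity fd gd \<psi> k w \<longleftrightarrow>
    (\<forall>x u v. (\<forall>j<k. \<psi> j x = 0 \<and>
        jac_d (\<psi> j) x *v (fd x + gd x *v u) + jac_a (\<psi> j) x *v v = 0) \<longrightarrow> v = w x u)"

definition has_differentiation_index ::
  "(('d::finite, 'a::finite) state \<Rightarrow> real ^ 'd) \<Rightarrow> (('d, 'a) state \<Rightarrow> real ^ 'u::finite ^ 'd)
    \<Rightarrow> (('d, 'a) state \<Rightarrow> real ^ 'm::finite) \<Rightarrow> (('d, 'a) state \<Rightarrow> real ^ 'u \<Rightarrow> real ^ 'a)
    \<Rightarrow> (nat \<Rightarrow> ('d, 'a) state \<Rightarrow> real ^ 'm) \<Rightarrow> nat \<Rightarrow> bool"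
  where "has_differentiation_index fd gd \<phi> w \<psi> \<nu> \<longleftrightarrow>
    1 \<le> \<nu> \<and>
    constraint_derivatives fd gd \<phi> w \<nu> \<psi> \<and>
    determines_velocity fd gd \<psi> \<nu> w \<and>
    (\<forall>k. 1 \<le> k \<and> k < \<nu> \<longrightarrow> \<not> (\<exists>w'. determines_velocity fd gd \<psi> k w'))"

text \<open>\<open>Jd \<psi> k\<close> and \<open>Ja \<psi> k\<close>, for \<open>k \<ge> 1\<close>, are the Jacobians of the \<open>(k - 1)\<close>-st derivative.\<close>

definition Jd :: "(nat \<Rightarrow> ('d::finite, 'a::finite) state \<Rightarrow> real ^ 'm::finite) \<Rightarrow> nat
    \<Rightarrow> ('d, 'a) state \<Rightarrow> real ^ 'd ^ 'm"
  where "Jd \<psi> k = jac_d (\<psi> (k - 1))"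

definition Ja :: "(nat \<Rightarrow> ('d::finite, 'a::finite) state \<Rightarrow> real ^ 'm::finite) \<Rightarrow> nat
    \<Rightarrow> ('d, 'a) state \<Rightarrow> real ^ 'a ^ 'm"
  where "Ja \<psi> k = jac_a (\<psi> (k - 1))"

text \<open>Moore-Penrose pseudoinverse, via the four Penrose equations.\<close>

definition pinv :: "real ^ 'n::finite ^ 'm::finite \<Rightarrow> real ^ 'm ^ 'n"
  where "pinv A = (THE X. A ** X ** A = A \<and> X ** A ** X = X \<and>
    transpose (A ** X) = A ** X \<and> transpose (X ** A) = X ** A)"

definition proj :: "(nat \<Rightarrow> ('d::finite, 'a::finite) state \<Rightarrow> real ^ 'm::finite) \<Rightarrow> nat
    \<Rightarrow> ('d, 'a) state \<Rightarrow> real ^ 'm ^ 'm"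
  where "proj \<psi> k x = mat 1 - Ja \<psi> k x ** pinv (Ja \<psi> k x)"

text \<open>Lie derivatives along \<open>fd\<close> and \<open>gd\<close> of functions of the state; \<open>fd\<close>, \<open>gd\<close> only have \<open>xd\<close>-components.\<close>

definition lie_fd :: "(('d::finite, 'a::finite) state \<Rightarrow> real ^ 'd)
    \<Rightarrow> (('d, 'a) state \<Rightarrow> real ^ 'n::finite) \<Rightarrow> ('d, 'a) state \<Rightarrow> real ^ 'n"
  where "lie_fd fd F x = jac_d F x *v fd x"

definition lie_gd :: "(('d::finite, 'a::finite) state \<Rightarrow> real ^ 'u::finite ^ 'd)
    \<Rightarrow> (('d, 'a) state \<Rightarrow> real ^ 'n::finite) \<Rightarrow> ('d, 'a) state \<Rightarrow> real ^ 'u ^ 'n"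
  where "lie_gd gd F x = jac_d F x ** gd x"

text \<open>\<open>d\<close> is the least integer \<open>\<ge> 1\<close> for which the matrix function below is not identically zero.\<close>

definition input_coupling ::
  "(('d::finite, 'a::finite) state \<Rightarrow> real ^ 'd) \<Rightarrow> (('d, 'a) state \<Rightarrow> real ^ 'u::finite ^ 'd)
    \<Rightarrow> (nat \<Rightarrow> ('d, 'a) state \<Rightarrow> real ^ 'm::finite) \<Rightarrow> nat \<Rightarrow> nat
    \<Rightarrow> ('d, 'a) state \<Rightarrow> real ^ 'u ^ 'm"
  where "input_coupling fd gd \<psi> \<nu> d x = Jd \<psi> \<nu> x ** lie_gd gd ((lie_fd fd ^^ (d - 1)) fst) x"

definition is_input_order ::
  "(('d::finite, 'a::finite) state \<Rightarrow> real ^ 'd) \<Rightarrow> (('d, 'a) state \<Rightarrow> real ^ 'u::finite ^ 'd)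
    \<Rightarrow> (nat \<Rightarrow> ('d, 'a) state \<Rightarrow> real ^ 'm::finite) \<Rightarrow> nat \<Rightarrow> nat \<Rightarrow> bool"
  where "is_input_order fd gd \<psi> \<nu> d \<longleftrightarrow>
    1 \<le> d \<and> (\<exists>x. input_coupling fd gd \<psi> \<nu> d x \<noteq> 0) \<and>
    (\<forall>j. 1 \<le> j \<and> j < d \<longrightarrow> (\<forall>x. input_coupling fd gd \<psi> \<nu> j x = 0))"

text \<open>
  \<open>\<eta>\<close>: the Jacobian \<open>Jd\<close> multiplied by the power \<open>d - 1\<close> of \<open>Jd fd\<close>. The power is a scalar one when
  there is a single constraint, and it is \<open>1\<close> when \<open>d = 1\<close>; these are the only cases used.
\<close>

definition eta :: "(('d::finite, 'a::finite) state \<Rightarrow> real ^ 'd)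
    \<Rightarrow> (nat \<Rightarrow> ('d, 'a) state \<Rightarrow> real ^ 'm::finite) \<Rightarrow> nat \<Rightarrow> nat \<Rightarrow> nat
    \<Rightarrow> ('d, 'a) state \<Rightarrow> real ^ 'd ^ 'm"
  where "eta fd \<psi> \<nu> d k x =
    (if \<nu> = 1 then Jd \<psi> k x
     else (\<chi> i j. ((Jd \<psi> k x *v fd x) $ i) ^ (d - 1) * Jd \<psi> k x $ i $ j))"

definition f_hat :: "(('d::finite, 'a::finite) state \<Rightarrow> real ^ 'd)
    \<Rightarrow> (nat \<Rightarrow> ('d, 'a) state \<Rightarrow> real ^ 'm::finite) \<Rightarrow> nat \<Rightarrow> ('d, 'a) state \<Rightarrow> ('d, 'a) state"
  where "f_hat fd \<psi> \<nu> x = (fd x, - (pinv (Ja \<psi> \<nu> x) *v (Jd \<psi> \<nu> x *v fd x)))"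

text \<open>The \<open>q\<close>-th column of the projected input matrix.\<close>

definition g_hat :: "(('d::finite, 'a::finite) state \<Rightarrow> real ^ 'u::finite ^ 'd)
    \<Rightarrow> (nat \<Rightarrow> ('d, 'a) state \<Rightarrow> real ^ 'm::finite) \<Rightarrow> nat \<Rightarrow> 'u \<Rightarrow> ('d, 'a) state \<Rightarrow> ('d, 'a) state"
  where "g_hat gd \<psi> \<nu> q x =
    (column q (gd x), - (pinv (Ja \<psi> \<nu> x) *v (Jd \<psi> \<nu> x *v column q (gd x))))"

definition lie :: "(('d::finite, 'a::finite) state \<Rightarrow> ('d, 'a) state)
    \<Rightarrow> (('d, 'a) state \<Rightarrow> real) \<Rightarrow> ('d, 'a) state \<Rightarrow> real"
  where "lie F b x = frechet_derivative b (at x) (F x)"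

text \<open>
  Row labels of \<open>A_bnd\<close>: \<open>Neg k i\<close> and \<open>Pos k i\<close> are the \<open>i\<close>-th rows of the \<open>k\<close>-th blocks of
  \<open>-P\<eta>g\<close> and \<open>P\<eta>g\<close>, \<open>Inp c\<close> is a row of \<open>A_u\<close>, and \<open>Bar\<close> is the last row. The matrix \<open>A_int\<close>
  consists of the rows other than \<open>Bar\<close>.
\<close>

datatype ('m, 'c) label = Neg nat 'm | Pos nat 'm | Inp 'c | Bar

definition rows_int :: "nat \<Rightarrow> ('m::finite, 'c::finite) label set"
  where "rows_int \<nu> = {Neg k i | k i. k \<in> {1..\<nu>}} \<union> {Pos k i | k i. k \<in> {1..\<nu>}} \<union> range Inp"

definition rows_bnd :: "nat \<Rightarrow> ('m::finite, 'c::finite) label set"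
  where "rows_bnd \<nu> = insert Bar (rows_int \<nu>)"

fun A_row :: "(('d::finite, 'a::finite) state \<Rightarrow> real ^ 'd)
    \<Rightarrow> (('d, 'a) state \<Rightarrow> real ^ 'u::finite ^ 'd) \<Rightarrow> (('d, 'a) state \<Rightarrow> real) \<Rightarrow> real ^ 'u ^ 'c::finite
    \<Rightarrow> (nat \<Rightarrow> ('d, 'a) state \<Rightarrow> real ^ 'm::finite) \<Rightarrow> nat \<Rightarrow> nat
    \<Rightarrow> ('d, 'a) state \<Rightarrow> ('m, 'c) label \<Rightarrow> real ^ 'u"
  where
    "A_row fd gd b Au \<psi> \<nu> d x (Neg k i) = - (proj \<psi> k x ** eta fd \<psi> \<nu> d k x ** gd x) $ i"
  | "A_row fd gd b Au \<psi> \<nu> d x (Pos k i) = (proj \<psi> k x ** eta fd \<psi> \<nu> d k x ** gd x) $ i"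
  | "A_row fd gd b Au \<psi> \<nu> d x (Inp c) = Au $ c"
  | "A_row fd gd b Au \<psi> \<nu> d x Bar = - (\<chi> q. lie (g_hat gd \<psi> \<nu> q) b x)"

fun r_row :: "(('d::finite, 'a::finite) state \<Rightarrow> real ^ 'd)
    \<Rightarrow> (('d, 'a) state \<Rightarrow> real) \<Rightarrow> real ^ 'c::finite
    \<Rightarrow> (nat \<Rightarrow> ('d, 'a) state \<Rightarrow> real ^ 'm::finite) \<Rightarrow> nat
    \<Rightarrow> ('d, 'a) state \<Rightarrow> ('m, 'c) label \<Rightarrow> real"
  where
    "r_row fd b ru \<psi> \<nu> x (Neg k i) = (proj \<psi> k x *v (Jd \<psi> k x *v fd x)) $ i"
  | "r_row fd b ru \<psi> \<nu> x (Pos k i) = - (proj \<psi> k x *v (Jd \<psi> k x *v fd x)) $ i"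
  | "r_row fd b ru \<psi> \<nu> x (Inp c) = ru $ c"
  | "r_row fd b ru \<psi> \<nu> x Bar = lie (f_hat fd \<psi> \<nu>) b x"

text \<open>
  A polynomial is a finitely supported map from monomials to coefficients, a monomial being a
  finitely supported map from indeterminates to exponents.
\<close>

type_synonym 'v mpoly = "('v \<Rightarrow>\<^sub>0 nat) \<Rightarrow>\<^sub>0 real"

definition mvar :: "'v \<Rightarrow> 'v mpoly"
  where "mvar v = Poly_Mapping.single (Poly_Mapping.single v 1) 1"

definition polys :: "'v set \<Rightarrow> 'v mpoly set"
  where "polys V = {p. \<forall>m \<in> Poly_Mapping.keys p. Poly_Mapping.keys m \<subseteq> V}"

definition meval :: "('v \<Rightarrow> real) \<Rightarrow> 'v mpoly \<Rightarrow> real"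
  where "meval \<alpha> p = (\<Sum>m \<in> Poly_Mapping.keys p. Poly_Mapping.lookup p m *
    (\<Prod>v \<in> Poly_Mapping.keys m. \<alpha> v ^ Poly_Mapping.lookup m v))"

definition sos :: "'v set \<Rightarrow> 'v mpoly set"
  where "sos V = {\<Sum>i<n. q i ^ 2 | (n::nat) q. \<forall>i<n. q i \<in> polys V}"

text \<open>The generators form a set, not a family; repeating a generator would not enlarge the cone.\<close>

definition poly_cone :: "'v set \<Rightarrow> 'v mpoly set \<Rightarrow> 'v mpoly set"
  where "poly_cone V G = {\<Sum>K \<in> Pow G. \<gamma> K * \<Prod>K | \<gamma>. \<forall>K \<in> Pow G. \<gamma> K \<in> sos V}"

text \<open>Indeterminates: the state components, one \<open>\<lambda>\<close> for each row label, and \<open>s\<close>.\<close>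

datatype ('d, 'a, 'l) indet = Xd 'd | Xa 'a | Lam 'l | Slack

definition state_vars :: "('d, 'a, 'l) indet set"
  where "state_vars = range Xd \<union> range Xa"

definition cert_vars :: "'l set \<Rightarrow> ('d, 'a, 'l) indet set"
  where "cert_vars R = state_vars \<union> Lam ` R \<union> {Slack}"

fun state_point :: "('d::finite, 'a::finite) state \<Rightarrow> ('d, 'a, 'l) indet \<Rightarrow> real"
  where
    "state_point x (Xd i) = fst x $ i"
  | "state_point x (Xa j) = snd x $ j"
  | "state_point x (Lam l) = 0"
  | "state_point x Slack = 0"

text \<open>\<open>p\<close> is the polynomial in \<open>x\<close> whose associated function is \<open>F\<close>; it is unique.\<close>

definition represents :: "('d::finite, 'a::finite, 'l) indet mpoly \<Rightarrow> (('d, 'a) state \<Rightarrow> real) \<Rightarrow> bool"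
  where "represents p F \<longleftrightarrow> p \<in> polys state_vars \<and> (\<forall>x. meval (state_point x) p = F x)"

text \<open>
  The polynomial \<open>\<phi>_int\<close>, for \<open>R = rows_int\<close>; \<open>\<phi>_bnd\<close> has the additional summand \<open>\<rho>b * b\<close>.
  Here \<open>pA\<close>, \<open>pr\<close>, \<open>p\<phi>\<close> are the polynomials representing \<open>A\<close>, \<open>r\<close> and the constraint.
\<close>

definition multiplier_poly ::
  "'l set \<Rightarrow> ('l \<Rightarrow> 'u::finite \<Rightarrow> ('d, 'a, 'l) indet mpoly) \<Rightarrow> ('l \<Rightarrow> ('d, 'a, 'l) indet mpoly)
    \<Rightarrow> ('m::finite \<Rightarrow> ('d, 'a, 'l) indet mpoly)
    \<Rightarrow> ('u \<Rightarrow> ('d, 'a, 'l) indet mpoly) \<Rightarrow> ('m \<Rightarrow> ('d, 'a, 'l) indet mpoly)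
    \<Rightarrow> ('d, 'a, 'l) indet mpoly \<Rightarrow> ('d, 'a, 'l) indet mpoly"
  where "multiplier_poly R pA pr p\<phi> \<rho> \<rho>\<phi> \<rho>s =
    (\<Sum>q\<in>UNIV. \<rho> q * (\<Sum>r\<in>R. mvar (Lam r) * pA r q)) +
    (\<Sum>l\<in>UNIV. \<rho>\<phi> l * p\<phi> l) +
    \<rho>s * (- (\<Sum>r\<in>R. mvar (Lam r) * pr r) - mvar Slack ^ 2)"

end

theory Submission
  imports Defs
begin

text \<open>
  At a counterexample \<open>(x, \<lambda>)\<close> evaluate the certificate with \<open>s = sqrt (- \<lambda> \<bullet> r) > 0\<close>. Every multiplier
  term vanishes and the cone element is nonnegative, since all generators of the cone are
  nonnegative there; so the left-hand side of the identity is at least \<open>s\<^sup>2 > 0\<close>. On the boundary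
  the term \<open>\<rho>b * b\<close> vanishes because continuity of \<open>b\<close> forces \<open>b x = 0\<close>.
\<close>

text \<open>The inner product of \<open>meval\<close>, separated so that its multiplicativity can be
  proved before any coefficients enter.\<close>

definition monom_eval :: "('v \<Rightarrow> 'r::comm_semiring_1) \<Rightarrow> ('v \<Rightarrow>\<^sub>0 nat) \<Rightarrow> 'r"
  where "monom_eval \<alpha> m = (\<Prod>v\<in>Poly_Mapping.keys m. \<alpha> v ^ Poly_Mapping.lookup m v)"

text \<open>Outside the support the exponent is 0 and the factor is 1. This allows monomials with
  different supports to be compared over one index set.\<close>

lemma monom_eval_superset:
  assumes "finite A" "Poly_Mapping.keys m \<subseteq> A"
  shows "monom_eval \<alpha> m = (\<Prod>v\<in>A. \<alpha> v ^ Poly_Mapping.lookup m v)"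
  unfolding monom_eval_def
  by (rule prod.mono_neutral_left) (use assms in \<open>auto simp: in_keys_iff\<close>)

lemma monom_eval_zero [simp]: "monom_eval \<alpha> 0 = 1"
  by (simp add: monom_eval_def)

text \<open>Monomials are multiplied by adding exponents, so over the union of both supports this is
  \<open>power_add\<close> factor by factor.\<close>

lemma monom_eval_add: "monom_eval \<alpha> (m + n) = monom_eval \<alpha> m * monom_eval \<alpha> n"
proof -
  let ?A = "Poly_Mapping.keys m \<union> Poly_Mapping.keys n"
  have "monom_eval \<alpha> k = (\<Prod>v\<in>?A. \<alpha> v ^ Poly_Mapping.lookup k v)" if "Poly_Mapping.keys k \<subseteq> ?A" for k
    using that by (intro monom_eval_superset) auto
  then show ?thesis
    using Poly_Mapping.keys_add[of m n]
    by (simp add: lookup_add power_add prod.distrib)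
qed

text \<open>Coefficients outside the support are 0. A common superset is what additivity requires,
  since cancellation can make the support of \<open>p + q\<close> smaller than the union of the
  supports.\<close>

lemma meval_superset:
  assumes "finite A" "Poly_Mapping.keys p \<subseteq> A"
  shows "meval \<alpha> p = (\<Sum>m\<in>A. Poly_Mapping.lookup p m * monom_eval \<alpha> m)"
  unfolding meval_def monom_eval_def
  by (rule sum.mono_neutral_left) (use assms in \<open>auto simp: in_keys_iff\<close>)

lemma meval_single [simp]: "meval \<alpha> (Poly_Mapping.single m c) = c * monom_eval \<alpha> m"
  by (subst meval_superset[of "{m}"]) (auto simp: keys_single)

lemma meval_zero [simp]: "meval \<alpha> 0 = 0"
  by (simp add: meval_def)

lemma meval_one [simp]: "meval \<alpha> 1 = 1"
  using meval_single[of \<alpha> 0 1] by simp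

lemma meval_add [simp]: "meval \<alpha> (p + q) = meval \<alpha> p + meval \<alpha> q"
proof -
  let ?A = "Poly_Mapping.keys p \<union> Poly_Mapping.keys q"
  have "meval \<alpha> k = (\<Sum>m\<in>?A. Poly_Mapping.lookup k m * monom_eval \<alpha> m)"
    if "Poly_Mapping.keys k \<subseteq> ?A" for k
    using that by (intro meval_superset) auto
  then show ?thesis
    using Poly_Mapping.keys_add[of p q]
    by (simp add: lookup_add distrib_right sum.distrib)
qed

lemma meval_uminus [simp]: "meval \<alpha> (- p) = - meval \<alpha> p"
  using meval_add[of \<alpha> p "- p"] by simp

lemma meval_diff [simp]: "meval \<alpha> (p - q) = meval \<alpha> p - meval \<alpha> q"
  using meval_add[of \<alpha> p "- q"] by simp

lemma meval_sum [simp]: "meval \<alpha> (\<Sum>i\<in>I. p i) = (\<Sum>i\<in>I. meval \<alpha> (p i))"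
  by (induction I rule: infinite_finite_induct) auto

text \<open>Reduces products of polynomials to products of single terms, which
  \<open>mult_single\<close> computes.\<close>

lemma poly_mapping_eq_sum_single:
  "p = (\<Sum>m\<in>Poly_Mapping.keys p. Poly_Mapping.single m (Poly_Mapping.lookup p m))"
proof (rule poly_mapping_eqI)
  fix m
  show "Poly_Mapping.lookup p m =
    Poly_Mapping.lookup (\<Sum>m\<in>Poly_Mapping.keys p. Poly_Mapping.single m (Poly_Mapping.lookup p m)) m"
    by (simp add: lookup_sum lookup_single when_def in_keys_iff)
qed

text \<open>On single terms this is \<open>monom_eval_add\<close>; the double sum over pairs of
  terms then factors. Together with additivity it makes evaluation a ring homomorphism, so a
  polynomial identity may be evaluated at any point.\<close>

lemma meval_mult [simp]: "meval \<alpha> (p * q) = meval \<alpha> p * meval \<alpha> q"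
proof -
  let ?p = "\<lambda>m. Poly_Mapping.single m (Poly_Mapping.lookup p m)"
  let ?q = "\<lambda>m. Poly_Mapping.single m (Poly_Mapping.lookup q m)"
  have "p * q = (\<Sum>m\<in>Poly_Mapping.keys p. \<Sum>n\<in>Poly_Mapping.keys q. ?p m * ?q n)"
    by (subst poly_mapping_eq_sum_single[of p], subst poly_mapping_eq_sum_single[of q])
      (rule sum_product)
  then have "meval \<alpha> (p * q) =
      (\<Sum>m\<in>Poly_Mapping.keys p. \<Sum>n\<in>Poly_Mapping.keys q.
        (Poly_Mapping.lookup p m * monom_eval \<alpha> m) * (Poly_Mapping.lookup q n * monom_eval \<alpha> n))"
    by (simp add: mult_single monom_eval_add mult_ac)
  also have "\<dots> = meval \<alpha> p * meval \<alpha> q"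
    by (simp add: sum_product meval_superset[OF finite_keys order_refl])
  finally show ?thesis .
qed

lemma meval_power [simp]: "meval \<alpha> (p ^ n) = meval \<alpha> p ^ n"
  by (induction n) auto

lemma meval_prod [simp]: "meval \<alpha> (\<Prod>i\<in>I. p i) = (\<Prod>i\<in>I. meval \<alpha> (p i))"
  by (induction I rule: infinite_finite_induct) auto

lemma meval_mvar [simp]: "meval \<alpha> (mvar v) = \<alpha> v"
  by (simp add: mvar_def monom_eval_def)

lemma meval_cong:
  assumes "p \<in> polys V" "\<And>v. v \<in> V \<Longrightarrow> \<alpha> v = \<beta> v"
  shows "meval \<alpha> p = meval \<beta> p"
  unfolding meval_def
proof (rule sum.cong[OF refl])
  fix m assume "m \<in> Poly_Mapping.keys p"
  with assms have "\<alpha> v = \<beta> v" if "v \<in> Poly_Mapping.keys m" for v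
    using that by (auto simp: polys_def)
  then show "Poly_Mapping.lookup p m * (\<Prod>v\<in>Poly_Mapping.keys m. \<alpha> v ^ Poly_Mapping.lookup m v) =
      Poly_Mapping.lookup p m * (\<Prod>v\<in>Poly_Mapping.keys m. \<beta> v ^ Poly_Mapping.lookup m v)"
    by simp
qed

text \<open>\<open>represents\<close> fixes values only at \<open>state_point x\<close>, where every
  \<open>Lam\<close> and \<open>Slack\<close> is 0. A representing polynomial contains state
  indeterminates alone, so its value persists when the other indeterminates are changed.\<close>

lemma meval_represents:
  assumes "represents p F" "\<And>v. v \<in> state_vars \<Longrightarrow> \<alpha> v = state_point x v"
  shows "meval \<alpha> p = F x"
  using assms meval_cong[of p state_vars \<alpha> "state_point x"] by (metis represents_def)

lemma meval_sos_nonneg: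
  assumes "p \<in> sos V"
  shows "0 \<le> meval \<alpha> p"
  using assms by (auto simp: sos_def intro!: sum_nonneg)

text \<open>Each summand is a sum of squares times a product of generators, and every generator is
  nonnegative at the point in question; for the empty \<open>K\<close> the product is 1.\<close>

lemma meval_poly_cone_nonneg:
  assumes "p \<in> poly_cone V G" "\<And>g. g \<in> G \<Longrightarrow> 0 \<le> meval \<alpha> g"
  shows "0 \<le> meval \<alpha> p"
proof -
  obtain \<gamma> where \<gamma>: "p = (\<Sum>K\<in>Pow G. \<gamma> K * \<Prod>K)" "\<forall>K\<in>Pow G. \<gamma> K \<in> sos V"
    using assms(1) by (auto simp: poly_cone_def)
  have "0 \<le> meval \<alpha> (\<gamma> K) * (\<Prod>g\<in>K. meval \<alpha> g)" if "K \<in> Pow G" for K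
    using that \<gamma>(2) assms(2) by (intro mult_nonneg_nonneg prod_nonneg) (auto intro: meval_sos_nonneg)
  then show ?thesis
    by (auto simp: \<gamma>(1) intro: sum_nonneg)
qed

text \<open>Extends the state \<open>x\<close> by a candidate ray \<open>l\<close> and a slack value
  \<open>s\<close>, in contrast to \<open>state_point\<close>, which puts zeros there.\<close>

fun cert_point :: "('d::finite, 'a::finite) state \<Rightarrow> ('l \<Rightarrow> real) \<Rightarrow> real \<Rightarrow> ('d, 'a, 'l) indet \<Rightarrow> real"
  where
    "cert_point x l s (Xd i) = fst x $ i"
  | "cert_point x l s (Xa j) = snd x $ j"
  | "cert_point x l s (Lam r) = l r"
  | "cert_point x l s Slack = s"

lemma meval_cert_point_represents:
  "represents p F \<Longrightarrow> meval (cert_point x l s) p = F x"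
  by (rule meval_represents) (auto simp: state_vars_def)

text \<open>The common core of both claims: \<open>\<tau>\<close> is 0 in the interior case and
  \<open>\<rho>b * pb\<close> on the boundary. The assumptions on \<open>G\<close> and
  \<open>\<tau>\<close> range over all slack values because \<open>s\<close> is chosen only inside
  the proof.\<close>

lemma certificate_excludes_ray:
  fixes x :: "('d::finite, 'a::finite) state" and A :: "('d, 'a) state \<Rightarrow> 'l \<Rightarrow> real ^ 'u::finite"
    and \<phi> :: "('d, 'a) state \<Rightarrow> real ^ 'm::finite"
  assumes identity: "\<Phi> + mvar Slack ^ 2 + (multiplier_poly R pA pr p\<phi> \<rho> \<rho>\<phi> \<rho>s + \<tau>) = 0"
    and rep_A: "\<And>r q. r \<in> R \<Longrightarrow> represents (pA r q) (\<lambda>x. A x r $ q)"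
    and rep_c: "\<And>r. r \<in> R \<Longrightarrow> represents (pr r) (\<lambda>x. c x r)"
    and rep_\<phi>: "\<And>i. represents (p\<phi> i) (\<lambda>x. \<phi> x $ i)"
    and cone: "\<Phi> \<in> poly_cone V G" "\<And>s g. g \<in> G \<Longrightarrow> 0 \<le> meval (cert_point x l s) g"
    and \<tau>: "\<And>s. meval (cert_point x l s) \<tau> = 0"
    and \<phi>: "\<phi> x = 0"
    and ray: "(\<Sum>r\<in>R. l r *\<^sub>R A x r) = 0"
  shows "0 \<le> (\<Sum>r\<in>R. l r * c x r)"
proof (rule ccontr)
  assume neg: "\<not> ?thesis"
  define s where "s = sqrt (- (\<Sum>r\<in>R. l r * c x r))"
  have s: "s ^ 2 = - (\<Sum>r\<in>R. l r * c x r)"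
    using neg by (simp add: s_def)
  \<comment> \<open>The multiplier \<open>\<rho> q\<close> is paired with the \<open>q\<close>-th
    coordinate of the vector equation \<open>ray\<close>.\<close>
  have "(\<Sum>r\<in>R. l r * A x r $ q) = 0" for q
    using arg_cong[OF ray, of "\<lambda>v. v $ q"] by simp
  \<comment> \<open>The three groups of summands vanish by the ray condition, by
    \<open>\<phi> x = 0\<close> and by the choice of \<open>s\<close>. The congruence rule supplies
    \<open>r \<in> R\<close>, under which alone \<open>A\<close> and \<open>c\<close> are
    represented.\<close>
  then have "meval (cert_point x l s) (multiplier_poly R pA pr p\<phi> \<rho> \<rho>\<phi> \<rho>s) = 0"
    by (simp add: multiplier_poly_def meval_cert_point_represents[OF rep_A]
        meval_cert_point_represents[OF rep_c] meval_cert_point_represents[OF rep_\<phi>] \<phi> s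
        cong: sum.cong_simp)
  then have "meval (cert_point x l s) \<Phi> + s ^ 2 = 0"
    using arg_cong[OF identity, of "meval (cert_point x l s)"] \<tau> by simp
  moreover have "0 \<le> meval (cert_point x l s) \<Phi>"
    using cone by (rule meval_poly_cone_nonneg)
  ultimately show False
    using s neg by linarith
qed

text \<open>The superlevel set is closed, so it contains its frontier; the open set where
  \<open>b\<close> is positive lies in its interior, so it misses the frontier.\<close>

lemma frontier_nonneg_eq_zero:
  fixes b :: "'a::topological_space \<Rightarrow> real"
  assumes "continuous_on UNIV b" "x \<in> frontier {x. 0 \<le> b x}"
  shows "b x = 0"
proof -
  have "closed {x. 0 \<le> b x}" "open {x. 0 < b x}"
    using assms(1) by (intro closed_Collect_le open_Collect_less continuous_intros; simp)+
  moreover have "{x. 0 < b x} \<subseteq> {x. 0 \<le> b x}"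
    by auto
  ultimately have "b x \<ge> 0" "\<not> b x > 0"
    using assms(2) interior_maximal[of "{x. 0 < b x}" "{x. 0 \<le> b x}"]
    by (auto simp: frontier_def)
  then show ?thesis
    by simp
qed

theorem proposition3:
  fixes fd :: "('d::finite, 'a::finite) state \<Rightarrow> real ^ 'd"
    and gd :: "('d, 'a) state \<Rightarrow> real ^ 'u::finite ^ 'd"
    and \<phi> :: "('d, 'a) state \<Rightarrow> real ^ 'm::finite"
    and b h :: "('d, 'a) state \<Rightarrow> real"
    and Au :: "real ^ 'u ^ 'c::finite" and ru :: "real ^ 'c"
    and w :: "('d, 'a) state \<Rightarrow> real ^ 'u \<Rightarrow> real ^ 'a"
    and \<psi> :: "nat \<Rightarrow> ('d, 'a) state \<Rightarrow> real ^ 'm"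
    and \<nu> d' :: nat
    and pA :: "('m, 'c) label \<Rightarrow> 'u \<Rightarrow> ('d, 'a, ('m, 'c) label) indet mpoly"
    and pr :: "('m, 'c) label \<Rightarrow> ('d, 'a, ('m, 'c) label) indet mpoly"
    and p\<phi> :: "'m \<Rightarrow> ('d, 'a, ('m, 'c) label) indet mpoly"
    and pb :: "('d, 'a, ('m, 'c) label) indet mpoly"
  assumes index: "has_differentiation_index fd gd \<phi> w \<psi> \<nu>"
    and order: "\<nu> = 1 \<or> is_input_order fd gd \<psi> \<nu> d' \<and> (d' = 1 \<or> CARD('m) = 1)"
    and poly_dyn: "polynomial_function fd" "polynomial_function gd"
    and poly_jac: "\<forall>k\<in>{1..\<nu>}. polynomial_function (Jd \<psi> k) \<and> polynomial_function (Ja \<psi> k)"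
    and poly_proj: "\<forall>k\<in>{1..\<nu>}. polynomial_function (proj \<psi> k)"
    and poly_sets: "polynomial_function \<phi>" "real_polynomial_function b" "real_polynomial_function h"
    and rep_A: "\<forall>r\<in>rows_bnd \<nu>. \<forall>q. represents (pA r q) (\<lambda>x. A_row fd gd b Au \<psi> \<nu> d' x r $ q)"
    and rep_r: "\<forall>r\<in>rows_bnd \<nu>. represents (pr r) (\<lambda>x. r_row fd b ru \<psi> \<nu> x r)"
    and rep_\<phi>: "\<forall>l. represents (p\<phi> l) (\<lambda>x. \<phi> x $ l)"
    and rep_b: "represents pb b"
    and cert_int:
      "\<exists>\<Phi> \<in> poly_cone (cert_vars (rows_int \<nu>)) (insert pb ((\<lambda>r. mvar (Lam r)) ` rows_int \<nu>)).
       \<exists>\<rho> \<rho>\<phi> \<rho>s. range \<rho> \<subseteq> polys (cert_vars (rows_int \<nu>)) \<and>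
         range \<rho>\<phi> \<subseteq> polys (cert_vars (rows_int \<nu>)) \<and> \<rho>s \<in> polys (cert_vars (rows_int \<nu>)) \<and>
         \<Phi> + mvar Slack ^ 2 + multiplier_poly (rows_int \<nu>) pA pr p\<phi> \<rho> \<rho>\<phi> \<rho>s = 0"
    and cert_bnd:
      "\<exists>\<Phi> \<in> poly_cone (cert_vars (rows_bnd \<nu>)) ((\<lambda>r. mvar (Lam r)) ` rows_bnd \<nu>).
       \<exists>\<rho> \<rho>\<phi> \<rho>b \<rho>s. range \<rho> \<subseteq> polys (cert_vars (rows_bnd \<nu>)) \<and>
         range \<rho>\<phi> \<subseteq> polys (cert_vars (rows_bnd \<nu>)) \<and> \<rho>b \<in> polys (cert_vars (rows_bnd \<nu>)) \<and>
         \<rho>s \<in> polys (cert_vars (rows_bnd \<nu>)) \<and>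
         \<Phi> + mvar Slack ^ 2 + (multiplier_poly (rows_bnd \<nu>) pA pr p\<phi> \<rho> \<rho>\<phi> \<rho>s + \<rho>b * pb) = 0"
  shows "(\<forall>x \<in> interior {x. 0 \<le> b x} \<inter> {x. \<phi> x = 0}.
            \<not> (\<exists>l. (\<forall>r\<in>rows_int \<nu>. 0 \<le> l r) \<and>
                   (\<Sum>r\<in>rows_int \<nu>. l r *\<^sub>R A_row fd gd b Au \<psi> \<nu> d' x r) = 0 \<and>
                   (\<Sum>r\<in>rows_int \<nu>. l r * r_row fd b ru \<psi> \<nu> x r) < 0)) \<and>
         (\<forall>x \<in> frontier {x. 0 \<le> b x} \<inter> {x. \<phi> x = 0}.
            \<not> (\<exists>l. (\<forall>r\<in>rows_bnd \<nu>. 0 \<le> l r) \<and>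
                   (\<Sum>r\<in>rows_bnd \<nu>. l r *\<^sub>R A_row fd gd b Au \<psi> \<nu> d' x r) = 0 \<and>
                   (\<Sum>r\<in>rows_bnd \<nu>. l r * r_row fd b ru \<psi> \<nu> x r) < 0))"
proof (intro conjI ballI notI; (elim exE conjE)?)
  fix x l
  assume x: "x \<in> interior {x. 0 \<le> b x} \<inter> {x. \<phi> x = 0}"
    and l: "\<forall>r\<in>rows_int \<nu>. 0 \<le> l r"
    and ray: "(\<Sum>r\<in>rows_int \<nu>. l r *\<^sub>R A_row fd gd b Au \<psi> \<nu> d' x r) = 0"
    and neg: "(\<Sum>r\<in>rows_int \<nu>. l r * r_row fd b ru \<psi> \<nu> x r) < 0"
  obtain \<Phi> \<rho> \<rho>\<phi> \<rho>s where
    cone: "\<Phi> \<in> poly_cone (cert_vars (rows_int \<nu>)) (insert pb ((\<lambda>r. mvar (Lam r)) ` rows_int \<nu>))"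
    and identity: "\<Phi> + mvar Slack ^ 2 + multiplier_poly (rows_int \<nu>) pA pr p\<phi> \<rho> \<rho>\<phi> \<rho>s = 0"
    using cert_int by blast
  \<comment> \<open>\<open>pb\<close> is a generator of the interior cone, so its value at
    \<open>x\<close> must be nonnegative; the remaining generators take the values
    \<open>l r\<close>.\<close>
  have "0 \<le> b x"
    using x interior_subset by blast
  then have "0 \<le> meval (cert_point x l s) g"
    if "g \<in> insert pb ((\<lambda>r. mvar (Lam r)) ` rows_int \<nu>)" for s g
    using that l meval_cert_point_represents[OF rep_b, of x] by auto
  \<comment> \<open>The added 0 plays the part of \<open>\<tau>\<close>.\<close>
  moreover have "\<Phi> + mvar Slack ^ 2 + (multiplier_poly (rows_int \<nu>) pA pr p\<phi> \<rho> \<rho>\<phi> \<rho>s + 0) = 0"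
    using identity by simp
  ultimately have "0 \<le> (\<Sum>r\<in>rows_int \<nu>. l r * r_row fd b ru \<psi> \<nu> x r)"
    using rep_A rep_r rep_\<phi> x cone ray
    by (intro certificate_excludes_ray[where A = "A_row fd gd b Au \<psi> \<nu> d'" and \<phi> = \<phi> and \<tau> = 0])
      (auto simp: rows_bnd_def)
  with neg show False
    by simp
next
  fix x l
  assume x: "x \<in> frontier {x. 0 \<le> b x} \<inter> {x. \<phi> x = 0}"
    and l: "\<forall>r\<in>rows_bnd \<nu>. 0 \<le> l r"
    and ray: "(\<Sum>r\<in>rows_bnd \<nu>. l r *\<^sub>R A_row fd gd b Au \<psi> \<nu> d' x r) = 0"
    and neg: "(\<Sum>r\<in>rows_bnd \<nu>. l r * r_row fd b ru \<psi> \<nu> x r) < 0"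
  obtain \<Phi> \<rho> \<rho>\<phi> \<rho>b \<rho>s where
    cone: "\<Phi> \<in> poly_cone (cert_vars (rows_bnd \<nu>)) ((\<lambda>r. mvar (Lam r)) ` rows_bnd \<nu>)"
    and identity:
      "\<Phi> + mvar Slack ^ 2 + (multiplier_poly (rows_bnd \<nu>) pA pr p\<phi> \<rho> \<rho>\<phi> \<rho>s + \<rho>b * pb) = 0"
    using cert_bnd by blast
  \<comment> \<open>Here \<open>b\<close> enters through \<open>\<rho>b * pb\<close>, where
    \<open>\<rho>b\<close> may have either sign, so the exact value 0 is required. Polynomial
    functions are continuous, which places the frontier in the zero set of \<open>b\<close>.\<close>
  have "b x = 0"
    using x poly_sets(2) frontier_nonneg_eq_zero[of b x]
    by (auto simp: real_polynomial_function_eq intro: continuous_on_polymonial_function)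
  then have "meval (cert_point x l s) (\<rho>b * pb) = 0" for s
    by (simp add: meval_cert_point_represents[OF rep_b])
  then have "0 \<le> (\<Sum>r\<in>rows_bnd \<nu>. l r * r_row fd b ru \<psi> \<nu> x r)"
    using rep_A rep_r rep_\<phi> x cone ray l
    by (intro certificate_excludes_ray[where A = "A_row fd gd b Au \<psi> \<nu> d'" and \<phi> = \<phi>, OF identity])
      auto
  with neg show False
    by simp
qed

end
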